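(* Let $\mathcal{H}$ be a connected $k$-uniform hypergraph with vertex set $\{1,\ldots,n\}$, and let $d_i$ be the degree of vertex $i$. Then \[ \min_{\gamma \in C(G_{\mathcal{A}_{\mathcal{H}}})}\Big(\prod_{i\in \gamma} d_i\Big)^{\frac{1}{|\gamma|}}\leqslant \rho(\mathcal{A}_{\mathcal{H}}) \leqslant \max_{\gamma \in C(G_{\mathcal{A}_{\mathcal{H}}})} \Big(\prod_{i\in \gamma} d_i\Big)^{\frac{1}{|\gamma|}}, \] and \[ \min_{\gamma \in C(G_{\mathcal{Q}_{\mathcal{H}}})}\Big(\prod_{i\in \gamma} 2d_i\Big)^{\frac{1}{|\gamma|}}\leqslant \rho(\mathcal{Q}_{\mathcal{H}}) \leqslant \max_{\gamma \in C(G_{\mathcal{Q}_{\mathcal{H}}})} \Big(\prod_{i\in \gamma} 2d_i\Big)^{\frac{1}{|\gamma|}}. \]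
   Context: A $k$-uniform hypergraph has each edge a set of exactly $k$ distinct vertices; the degree of a vertex is the number of edges containing it. The adjacency tensor $\mathcal{A}_{\mathcal{H}}=(a_{i_1\cdots i_k})$ is the order $k$ dimension $n$ tensor with $a_{i_1\cdots i_k}=\frac{1}{(k-1)!}$ if $\{i_1,\ldots,i_k\}$ is an edge and $0$ otherwise. The degree tensor $\mathcal{D}_{\mathcal{H}}$ is the order $k$ dimension $n$ diagonal tensor with $(i,\ldots,i)$-entry $d_i$, and $\mathcal{Q}_{\mathcal{H}}=\mathcal{D}_{\mathcal{H}}+\mathcal{A}_{\mathcal{H}}$ is the signless Laplacian tensor. For an order $m$ dimension $n$ tensor $\mathcal{T}=(t_{i_1\cdots i_m})$: $(\mathcal{T}x^{m-1})_i=\sum_{i_2,\ldots,i_m}t_{ii_2\cdots i_m}x_{i_2}\cdots x_{i_m}$; $\lambda\in\mathbb{C}$ is an eigenvalue if $\mathcal{T}x^{m-1}=\lambda(x_1^{m-1},\ldots,x_n^{m-1})^{\mathrm T}$ for some nonzero $x\in\mathbb{C}^n$; $\rho(\mathcal{T})$ is the maximum modulus of eigenvalues. The digraph $G_{\mathcal{T}}$ has vertices $\{1,\ldots,n\}$ and an arc $(i,j)$ whenever $t_{ii_2\cdots i_m}\neq0$ for some $i_2,\ldots,i_m$ with $j\in\{i_2,\ldots,i_m\}$ (loops allowed). $C(G_{\mathcal{T}})$ is the set of circuits of $G_{\mathcal{T}}$, i.e. directed closed paths $i_1\to\cdots\to i_p\to i_1$ with $i_1,\ldots,i_p$ distinct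 (loops, $p=1$, allowed); $|\gamma|=p$ and $\prod_{i\in\gamma}$ is the product over $i_1,\ldots,i_p$. *)

theory Defs
  imports "HOL-Analysis.Analysis" "Graph_Theory.Pair_Digraph"
begin

text \<open>
  The index set $\{1,\ldots,n\}$ is a finite type \<open>'n\<close> with \<open>CARD('n)\<close> $= n$.
  The order of a tensor is a separate parameter \<open>m\<close>: a tensor of order \<open>m\<close> sends the index
  tuple $(i_1,\ldots,i_m)$, a list of length \<open>m\<close>, to $t_{i_1\cdots i_m}$; its values on lists of
  any other length are irrelevant.
\<close>

type_synonym 'n tensor = "'n list \<Rightarrow> complex"

definition tensor_apply :: "nat \<Rightarrow> 'n::finite tensor \<Rightarrow> complex ^ 'n \<Rightarrow> complex ^ 'n" where
  "tensor_apply m T x = (\<chi> i. \<Sum>is\<in>{is. length is = m - 1}. T (i # is) * (\<Prod>j\<leftarrow>is. x $ j))"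

definition tensor_eigenvalue :: "nat \<Rightarrow> 'n::finite tensor \<Rightarrow> complex \<Rightarrow> bool" where
  "tensor_eigenvalue m T l \<longleftrightarrow>
     (\<exists>x. x \<noteq> 0 \<and> tensor_apply m T x = (\<chi> i. l * (x $ i) ^ (m - 1)))"

definition tensor_spectral_radius :: "nat \<Rightarrow> 'n::finite tensor \<Rightarrow> real" where
  "tensor_spectral_radius m T = (GREATEST r. \<exists>l. tensor_eigenvalue m T l \<and> r = cmod l)"

definition tensor_digraph :: "nat \<Rightarrow> 'n tensor \<Rightarrow> 'n pair_pre_digraph" where
  "tensor_digraph m T =
     \<lparr> pverts = UNIV,
       parcs = {(i, j). \<exists>is. length is = m - 1 \<and> j \<in> set is \<and> T (i # is) \<noteq> 0} \<rparr>"

text \<open>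
  A circuit is recorded by the list $i_1,\ldots,i_p$ of its vertices. The library predicate
  \<open>cycle\<close> on arc lists allows loops and requires the vertices to be distinct; each circuit occurs
  once for every choice of its starting vertex.
\<close>

definition circuits :: "'n pair_pre_digraph \<Rightarrow> 'n list set" where
  "circuits G = {map fst p | p. pre_digraph.cycle (with_proj G) p}"

text \<open>A hypergraph on the vertex set \<open>UNIV\<close> is given by its set of edges.\<close>

definition uniform_hypergraph :: "nat \<Rightarrow> 'n set set \<Rightarrow> bool" where
  "uniform_hypergraph k E \<longleftrightarrow> (\<forall>e\<in>E. card e = k)"

definition hypergraph_connected :: "'n set set \<Rightarrow> bool" where
  "hypergraph_connected E \<longleftrightarrow> (\<forall>u v. (u, v) \<in> {(a, b). \<exists>e\<in>E. a \<in> e \<and> b \<in> e}\<^sup>*)"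

definition hdegree :: "'n set set \<Rightarrow> 'n \<Rightarrow> nat" where
  "hdegree E i = card {e \<in> E. i \<in> e}"

text \<open>
  When all edges have exactly \<open>k\<close> elements, \<open>set is \<in> E\<close> forces the entries of a list \<open>is\<close> of
  length \<open>k\<close> to be distinct.
\<close>

definition adjacency_tensor :: "nat \<Rightarrow> 'n set set \<Rightarrow> 'n tensor" where
  "adjacency_tensor k E is = (if set is \<in> E then 1 / fact (k - 1) else 0)"

definition degree_tensor :: "nat \<Rightarrow> 'n set set \<Rightarrow> 'n tensor" where
  "degree_tensor k E is = (if is = replicate k (hd is) then of_nat (hdegree E (hd is)) else 0)"

definition signless_laplacian_tensor :: "nat \<Rightarrow> 'n set set \<Rightarrow> 'n tensor" where
  "signless_laplacian_tensor k E is = degree_tensor k E is + adjacency_tensor k E is"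

end

theory Submission
  imports Defs "HOL-Combinatorics.Multiset_Permutations"
begin

text \<open>
  For a nonnegative weakly irreducible tensor the least \<open>r\<close> such that
  $\mathcal{T}x^{m-1} \leq r x^{[m-1]}$ for some positive \<open>x\<close> is attained: such an \<open>x\<close> can grow
  along an arc only by a bounded factor relative to its smallest entry, so by strong connectivity
  the normalised candidates lie in a compact box of positive vectors. A suitable minimiser is an
  eigenvector, and comparison with it bounds every eigenvalue, so \<open>r\<close> is the spectral radius.
  Following from each index its out-neighbour with the largest (smallest) entry of the eigenvector
  ends in a circuit, along which the eigenvector cancels and only the row sums remain. The row sums
  are $d_i$ for the adjacency tensor and $2d_i$ for the signless Laplacian tensor.
\<close>

section \<open>Circuits of a digraph on a finite type\<close>

lemma pawalk_verts_eq_map_snd: "pcas u p v \<Longrightarrow> pawalk_verts u p = u # map snd p"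
  by (induction p arbitrary: u) auto

text \<open>\<open>Min\<close> and \<open>Max\<close> over circuits carry meaning only on a finite
  set. The heads of the arcs of a cycle are distinct, which bounds its length by the number of
  vertices.\<close>

lemma finite_circuits: "finite (circuits (G :: 'n::finite pair_pre_digraph))"
proof (rule finite_subset)
  show "circuits G \<subseteq> {xs. set xs \<subseteq> UNIV \<and> length xs \<le> CARD('n)}"
  proof
    fix \<gamma> assume "\<gamma> \<in> circuits G"
    then obtain p u where \<gamma>: "\<gamma> = map fst p" and w: "pre_digraph.awalk (with_proj G) u p u"
      and d: "distinct (tl (pre_digraph.awalk_verts (with_proj G) u p))"
      by (auto simp: circuits_def pre_digraph.cycle_def)
    have "pcas u p u"
      using w by (simp add: pre_digraph.awalk_def cas_with_proj_eq)
    with d have "distinct (map snd p)"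
      by (simp add: awalk_verts_with_proj_eq pawalk_verts_eq_map_snd)
    then have "card (set (map snd p)) = length p"
      by (metis distinct_card length_map)
    moreover have "card (set (map snd p)) \<le> CARD('n)"
      by (rule card_mono) auto
    ultimately show "\<gamma> \<in> {xs. set xs \<subseteq> UNIV \<and> length xs \<le> CARD('n)}"
      by (simp add: \<gamma>)
  qed
qed (rule finite_lists_length_le, simp)

lemma pcas_funpow:
  "pcas u (map (\<lambda>q. ((f ^^ q) u, f ((f ^^ q) u))) [0..<p]) ((f ^^ p) u)"
proof (induction p arbitrary: u)
  case (Suc p)
  have "[0..<Suc p] = 0 # map Suc [0..<p]"
    by (simp add: upt_conv_Cons map_Suc_upt del: upt_Suc)
  then show ?case
    using Suc.IH[of "f u"] by (simp add: o_def funpow_swap1 del: upt_Suc)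
qed simp

text \<open>Iterating a self-map of a finite set reaches a periodic point, and the orbit of that
  point over its least period is a circuit that \<open>f\<close> permutes.\<close>

lemma ex_circuit_of_selfmap:
  fixes G :: "'n::finite pair_pre_digraph" and f :: "'n \<Rightarrow> 'n"
  assumes "pverts G = UNIV" and arc: "\<And>i. (i, f i) \<in> parcs G"
  obtains \<gamma> where "\<gamma> \<in> circuits G" "\<gamma> \<noteq> []" "distinct \<gamma>" "f ` set \<gamma> = set \<gamma>"
proof -
  \<comment> \<open>\<open>undefined\<close> serves as an arbitrary starting vertex. By pigeonhole
    two of its iterates coincide, so the earlier one is periodic.\<close>
  have "\<not> inj (\<lambda>q. (f ^^ q) undefined)"
    by (meson finite finite_imageD finite_subset infinite_UNIV_nat subset_UNIV)
  then obtain a b where "(f ^^ a) undefined = (f ^^ b) undefined" "a < b"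
    unfolding inj_def by (metis linorder_neqE_nat)
  moreover have "(f ^^ b) undefined = (f ^^ (b - a)) ((f ^^ a) undefined)"
    using \<open>a < b\<close> funpow_add[of "b - a" a f] by simp
  ultimately have ex: "(f ^^ (b - a)) ((f ^^ a) undefined) = (f ^^ a) undefined" "0 < b - a"
    by simp_all
  define i where "i = (f ^^ a) undefined"
  define p where "p = (LEAST p. 0 < p \<and> (f ^^ p) i = i)"
  have p: "0 < p" "(f ^^ p) i = i"
    using LeastI[of "\<lambda>p. 0 < p \<and> (f ^^ p) i = i" "b - a"] ex by (auto simp: p_def i_def)
  have least: "(f ^^ q) i \<noteq> i" if "0 < q" "q < p" for q
    using not_less_Least[of q "\<lambda>p. 0 < p \<and> (f ^^ p) i = i"] that by (auto simp: p_def)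
  define \<gamma> where "\<gamma> = map (\<lambda>q. (f ^^ q) i) [0..<p]"
  \<comment> \<open>If two iterates within one period coincided, applying
    \<open>f ^^ (p - r)\<close> to both would give the smaller period
    \<open>p - r + q\<close>.\<close>
  have "(f ^^ q) i \<noteq> (f ^^ r) i" if "q < r" "r < p" for q r
  proof
    assume "(f ^^ q) i = (f ^^ r) i"
    then have "(f ^^ (p - r)) ((f ^^ q) i) = (f ^^ (p - r)) ((f ^^ r) i)" by simp
    then have "(f ^^ (p - r + q)) i = (f ^^ (p - r + r)) i"
      by (simp only: funpow_add o_apply)
    moreover have "0 < p - r + q" "p - r + q < p" "p - r + r = p" using that by simp_all
    ultimately show False using least[of "p - r + q"] p by simp
  qed
  then have "inj_on (\<lambda>q. (f ^^ q) i) {0..<p}"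
    by (intro linorder_inj_onI) auto
  then have dist: "distinct \<gamma>" by (simp add: \<gamma>_def distinct_map)
  have ne: "\<gamma> \<noteq> []" using p by (simp add: \<gamma>_def)
  have sub: "f ` set \<gamma> \<subseteq> set \<gamma>"
  proof clarify
    fix x assume "x \<in> set \<gamma>"
    then obtain q where q: "q < p" "x = (f ^^ q) i" by (auto simp: \<gamma>_def)
    show "f x \<in> set \<gamma>"
    proof (cases "Suc q < p")
      case True
      then have "(f ^^ Suc q) i \<in> set \<gamma>" unfolding \<gamma>_def by force
      then show ?thesis using q by simp
    next
      case False
      then have "Suc q = p" using q by simp
      then have "f x = i" using p q by auto
      then show ?thesis using p by (force simp: \<gamma>_def)
    qed
  qed
  have "set \<gamma> \<subseteq> f ` set \<gamma>"
  proof
    fix x assume "x \<in> set \<gamma>"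
    then obtain q where q: "q < p" "x = (f ^^ q) i" by (auto simp: \<gamma>_def)
    have "\<exists>r<p. x = f ((f ^^ r) i)"
    proof (cases q)
      case 0
      have "f ((f ^^ (p - 1)) i) = i" using p by (cases p) auto
      then show ?thesis using 0 p q by (intro exI[of _ "p - 1"]) simp
    next
      case (Suc r)
      then show ?thesis using q by (intro exI[of _ r]) simp
    qed
    then show "x \<in> f ` set \<gamma>" by (auto simp: \<gamma>_def)
  qed
  with sub have img: "f ` set \<gamma> = set \<gamma>" by blast
  let ?w = "map (\<lambda>j. (j, f j)) \<gamma>"
  have "pcas i ?w i"
    using pcas_funpow[of i f p] p by (simp add: \<gamma>_def o_def)
  then have "pre_digraph.awalk (with_proj G) i ?w i"
    using assms by (auto simp: pre_digraph.awalk_def cas_with_proj_eq)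
  \<comment> \<open>\<open>cycle\<close> asks for distinct arc heads, here
    \<open>map f \<gamma>\<close>. Its set is \<open>set \<gamma>\<close> and its length is that of
    the distinct list \<open>\<gamma>\<close>, so counting suffices.\<close>
  moreover have "distinct (map f \<gamma>)"
    by (rule card_distinct) (simp add: img dist distinct_card)
  then have "distinct (tl (pre_digraph.awalk_verts (with_proj G) i ?w))"
    using \<open>pcas i ?w i\<close> by (simp add: awalk_verts_with_proj_eq pawalk_verts_eq_map_snd o_def)
  ultimately have "pre_digraph.cycle (with_proj G) ?w"
    using ne by (auto simp: pre_digraph.cycle_def)
  moreover have "\<gamma> = map fst ?w" by (simp add: o_def)
  ultimately have "\<gamma> \<in> circuits G" unfolding circuits_def by blast
  then show thesis using that ne dist img by blast
qed

text \<open>Multiply the inequalities over a circuit of \<open>f\<close>: as \<open>f\<close>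
  permutes its vertices, the weights on both sides have the same positive product and
  cancel.\<close>

lemma ex_circuit_of_subinvariant_weight:
  fixes G :: "'n::finite pair_pre_digraph" and f :: "'n \<Rightarrow> 'n" and w a b :: "'n \<Rightarrow> real"
  assumes G: "pverts G = UNIV" "\<And>i. (i, f i) \<in> parcs G"
    and w: "\<And>i. 0 < w i" and a: "\<And>i. 0 \<le> a i" and b: "\<And>i. 0 \<le> b i"
    and le: "\<And>i. a i * w i \<le> b i * w (f i)"
  obtains \<gamma> where "\<gamma> \<in> circuits G" "\<gamma> \<noteq> []" "distinct \<gamma>" "prod a (set \<gamma>) \<le> prod b (set \<gamma>)"
proof -
  obtain \<gamma> where \<gamma>: "\<gamma> \<in> circuits G" "\<gamma> \<noteq> []" "distinct \<gamma>" "f ` set \<gamma> = set \<gamma>"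
    using ex_circuit_of_selfmap[OF G] by blast
  then have "inj_on f (set \<gamma>)" by (simp add: eq_card_imp_inj_on)
  then have perm: "(\<Prod>i\<in>set \<gamma>. w (f i)) = (\<Prod>i\<in>set \<gamma>. w i)"
    using \<gamma>(4) by (metis prod.reindex_cong)
  have "(\<Prod>i\<in>set \<gamma>. a i * w i) \<le> (\<Prod>i\<in>set \<gamma>. b i * w (f i))"
    by (rule prod_mono) (simp add: a w le less_imp_le)
  then have "prod a (set \<gamma>) * prod w (set \<gamma>) \<le> prod b (set \<gamma>) * prod w (set \<gamma>)"
    by (simp add: prod.distrib perm)
  moreover have "0 < prod w (set \<gamma>)" by (simp add: prod_pos w)
  ultimately have "prod a (set \<gamma>) \<le> prod b (set \<gamma>)" by simp
  then show thesis using that \<gamma> by blast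
qed

section \<open>Geometric means along circuits\<close>

definition circuit_mean :: "('n \<Rightarrow> real) \<Rightarrow> 'n list \<Rightarrow> real" where
  "circuit_mean r \<gamma> = (\<Prod>i\<in>set \<gamma>. r i) powr (1 / real (length \<gamma>))"

lemma circuit_mean_mono:
  assumes "\<And>i. i \<in> set \<gamma> \<Longrightarrow> 0 \<le> a i" "prod a (set \<gamma>) \<le> prod b (set \<gamma>)"
  shows "circuit_mean a \<gamma> \<le> circuit_mean b \<gamma>"
  unfolding circuit_mean_def by (intro powr_mono2) (use assms in \<open>auto intro: prod_nonneg\<close>)

lemma circuit_mean_const:
  assumes "distinct \<gamma>" "\<gamma> \<noteq> []" "0 \<le> \<rho>"
  shows "circuit_mean (\<lambda>_. \<rho>) \<gamma> = \<rho>"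
proof (cases "\<rho> = 0")
  case False
  then have "(\<rho> ^ length \<gamma>) powr (1 / real (length \<gamma>)) = \<rho>"
    using assms by (simp add: powr_powr flip: powr_realpow)
  then show ?thesis using assms by (simp add: circuit_mean_def distinct_card)
qed (use assms in \<open>simp add: circuit_mean_def card_gt_0_iff\<close>)

section \<open>Nonnegative weakly irreducible tensors\<close>

definition monomial_at :: "real ^ 'n \<Rightarrow> 'n list \<Rightarrow> real" where
  "monomial_at x is = (\<Prod>j\<leftarrow>is. x $ j)"

lemma monomial_at_Nil [simp]: "monomial_at x [] = 1"
  and monomial_at_Cons [simp]: "monomial_at x (j # is) = x $ j * monomial_at x is"
  by (simp_all add: monomial_at_def)

lemma monomial_at_pos: "(\<And>j. 0 < x $ j) \<Longrightarrow> 0 < monomial_at x is"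
  by (induction "is") auto

lemma monomial_at_mono:
  "(\<And>j. j \<in> set is \<Longrightarrow> 0 \<le> x $ j \<and> x $ j \<le> y $ j) \<Longrightarrow>
   0 \<le> monomial_at x is \<and> monomial_at x is \<le> monomial_at y is"
proof (induction "is")
  case (Cons j "is")
  then have "0 \<le> monomial_at x is" "monomial_at x is \<le> monomial_at y is"
    and "0 \<le> x $ j" "x $ j \<le> y $ j" by auto
  then show ?case by (auto intro!: mult_mono)
qed simp

text \<open>Positivity keeps the other factors from vanishing, so a strict increase in a single
  factor survives in the product.\<close>

lemma monomial_at_strict_mono:
  assumes "\<And>j. 0 < x $ j" "\<And>j. x $ j \<le> y $ j" "x $ l < y $ l" "l \<in> set is"
  shows "monomial_at x is < monomial_at y is"
  using assms(4)
proof (induction "is")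
  case (Cons j "is")
  have pos: "0 < y $ i" for i using assms(1,2)[of i] by linarith
  have le: "monomial_at x is \<le> monomial_at y is"
    using monomial_at_mono[of "is" x y] assms by (simp add: less_imp_le)
  have "0 < monomial_at x is" "0 < monomial_at y is"
    using assms(1) pos by (auto intro: monomial_at_pos)
  then show ?case
    using Cons assms pos[of j] le
    by (cases "j = l") (auto intro: mult_less_le_imp_less mult_le_less_imp_less less_imp_le)
qed simp

lemma monomial_at_const: "monomial_at (\<chi> i. c) is = c ^ length is"
  by (induction "is") auto

lemma monomial_at_scale: "monomial_at (c *\<^sub>R x) is = c ^ length is * monomial_at x is"
  by (induction "is") auto

text \<open>Keep one occurrence of the factor \<open>x $ l\<close> and bound every other factor
  below by \<open>s\<close>. This isolates the entry at the head of an arc in the growth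
  estimate.\<close>

lemma monomial_at_ge_remove:
  assumes "\<And>j. s \<le> x $ j" "0 \<le> s" "l \<in> set is"
  shows "x $ l * s ^ (length is - 1) \<le> monomial_at x is"
  using assms(3)
proof (induction "is")
  case (Cons j "is")
  have ge: "s ^ length is \<le> monomial_at x is"
    using monomial_at_mono[of "is" "\<chi> i. s" x] assms by (simp add: monomial_at_const)
  have nn: "0 \<le> x $ i" for i using assms(1,2) order_trans by blast
  show ?case
  proof (cases "j = l")
    case True
    then show ?thesis using ge nn by (simp add: mult_left_mono)
  next
    case False
    then have l: "l \<in> set is" using Cons.prems by simp
    then have "length is = Suc (length is - 1)" by (cases "is") auto
    then have "x $ l * s ^ length is = s * (x $ l * s ^ (length is - 1))"
      by (metis mult.left_commute power_Suc)
    also have "\<dots> \<le> x $ j * monomial_at x is"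
      using Cons.IH[OF l] assms nn by (intro mult_mono) auto
    finally show ?thesis by simp
  qed
qed simp

lemma continuous_on_monomial_at [continuous_intros]:
  "continuous_on S g \<Longrightarrow> continuous_on S (\<lambda>x. monomial_at (g x) is)"
  by (induction "is") (auto intro!: continuous_intros)

lemma finite_lists_length_eq_UNIV [simp]: "finite {is :: 'n::finite list. length is = q}"
  using finite_lists_length_eq[of "UNIV :: 'n set" q] by simp

lemma of_real_monomial_at:
  "(\<Prod>j\<leftarrow>is. (\<chi> i. complex_of_real (x $ i)) $ j) = complex_of_real (monomial_at x is)"
  by (induction "is") auto

lemma norm_prod_list_nth:
  fixes z :: "complex ^ 'n"
  shows "cmod (\<Prod>j\<leftarrow>is. z $ j) = monomial_at (\<chi> i. cmod (z $ i)) is"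
  by (induction "is") (auto simp: norm_mult)

text \<open>Weak irreducibility is strong connectivity of the associated digraph. The reflexive
  closure alone would allow a single index without arcs; two indices force an arc out of every
  index.\<close>

locale weakly_irreducible_tensor =
  fixes m :: nat and t :: "'n::finite list \<Rightarrow> real"
  assumes nonneg: "0 \<le> t is"
    and irreducible: "(i, j) \<in> (parcs (tensor_digraph m (\<lambda>is. complex_of_real (t is))))\<^sup>*"
    and two_indices: "CARD('n) \<ge> 2"
begin

abbreviation T :: "'n tensor" where "T \<equiv> \<lambda>is. complex_of_real (t is)"

abbreviation G :: "'n pair_pre_digraph" where "G \<equiv> tensor_digraph m T"

section \<open>Row forms, row sums and growth along arcs\<close>

definition row_form :: "real ^ 'n \<Rightarrow> 'n \<Rightarrow> real" where
  "row_form x i = (\<Sum>is\<in>{is. length is = m - 1}. t (i # is) * monomial_at x is)"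

definition row_sum :: "'n \<Rightarrow> real" where
  "row_sum i = (\<Sum>is\<in>{is. length is = m - 1}. t (i # is))"

lemma pverts_G: "pverts G = UNIV"
  by (simp add: tensor_digraph_def)

lemma arc_iff: "(i, j) \<in> parcs G \<longleftrightarrow> (\<exists>is. length is = m - 1 \<and> j \<in> set is \<and> 0 < t (i # is))"
  using nonneg by (auto simp: tensor_digraph_def less_le)

lemma ex_arc_leaving:
  assumes "i \<in> I" "j \<notin> I"
  obtains u v where "u \<in> I" "v \<notin> I" "(u, v) \<in> parcs G"
proof -
  have "\<exists>u v. u \<in> I \<and> v \<notin> I \<and> (u, v) \<in> parcs G"
    using irreducible[of i j] assms by (induction rule: rtrancl_induct) blast+
  then show thesis using that by blast
qed

lemma ex_out_arc: "\<exists>j. (i, j) \<in> parcs G"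
proof -
  have "UNIV \<noteq> {i}"
  proof
    assume "UNIV = {i}"
    then have "CARD('n) = card {i}" by simp
    then show False using two_indices by simp
  qed
  then obtain j where "j \<noteq> i" by blast
  then show ?thesis using irreducible[of i j] by (metis converse_rtranclE)
qed

lemma order_ge_2: "2 \<le> m"
proof -
  obtain i j where "(i, j) \<in> parcs G" using ex_out_arc by blast
  then obtain "is" where "length is = m - 1" "j \<in> set is" by (auto simp: arc_iff)
  then show ?thesis by (cases "is") auto
qed

lemma row_sum_nonneg: "0 \<le> row_sum i"
  unfolding row_sum_def by (intro sum_nonneg nonneg)

lemma row_form_const: "row_form (\<chi> i. c) i = row_sum i * c ^ (m - 1)"
  by (simp add: row_form_def row_sum_def monomial_at_const sum_distrib_right)

lemma row_form_scale: "row_form (c *\<^sub>R x) i = c ^ (m - 1) * row_form x i"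
  by (simp add: row_form_def monomial_at_scale sum_distrib_left mult.left_commute)

lemma row_form_mono:
  assumes "\<And>j. 0 \<le> x $ j" "\<And>j. x $ j \<le> y $ j"
  shows "row_form x i \<le> row_form y i"
  unfolding row_form_def using assms monomial_at_mono[of _ x y]
  by (intro sum_mono mult_left_mono nonneg) auto

lemma row_form_nonneg: "(\<And>j. 0 \<le> x $ j) \<Longrightarrow> 0 \<le> row_form x i"
  unfolding row_form_def using monomial_at_mono[of _ x x]
  by (intro sum_nonneg mult_nonneg_nonneg nonneg) auto

lemma row_form_strict_mono:
  assumes "\<And>j. 0 < x $ j" "\<And>j. x $ j \<le> y $ j" "x $ l < y $ l" "(i, l) \<in> parcs G"
  shows "row_form x i < row_form y i"
proof -
  obtain "is" where "is": "length is = m - 1" "l \<in> set is" "0 < t (i # is)"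
    using assms(4) by (auto simp: arc_iff)
  show ?thesis unfolding row_form_def
  proof (rule sum_strict_mono_ex1)
    show "\<forall>js\<in>{is. length is = m - 1}. t (i # js) * monomial_at x js \<le> t (i # js) * monomial_at y js"
      using assms monomial_at_mono[of _ x y] by (auto intro!: mult_left_mono nonneg simp: less_imp_le)
    show "\<exists>js\<in>{is. length is = m - 1}. t (i # js) * monomial_at x js < t (i # js) * monomial_at y js"
      using "is" monomial_at_strict_mono[of x y l "is"] assms by (intro bexI[of _ "is"]) auto
  qed simp
qed

lemma row_form_ge_term:
  assumes "\<And>j. 0 \<le> x $ j" "length is = m - 1"
  shows "t (i # is) * monomial_at x is \<le> row_form x i"
  unfolding row_form_def using assms monomial_at_mono[of _ x x] nonneg
  by (intro member_le_sum) auto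

text \<open>Induction along a path that starts at an index \<open>s\<close> of a smallest entry. The
  quantifier order matters: \<open>K\<close> depends on the path and on \<open>M\<close>, but not on
  \<open>x\<close>.\<close>

lemma ex_growth_bound:
  assumes "0 \<le> M" "(s, j) \<in> (parcs G)\<^sup>*"
  shows "\<exists>K\<ge>0. \<forall>x. (\<forall>i. 0 < x $ i) \<longrightarrow> (\<forall>i. row_form x i \<le> M * x $ i ^ (m - 1)) \<longrightarrow>
    (\<forall>i. x $ s \<le> x $ i) \<longrightarrow> x $ j \<le> K * x $ s"
  using assms(2)
proof (induction rule: rtrancl_induct)
  case base
  then show ?case by (intro exI[of _ 1]) auto
next
  case (step j l)
  then obtain K where K: "0 \<le> K"
    "\<And>x. \<lbrakk>\<And>i. 0 < x $ i; \<And>i. row_form x i \<le> M * x $ i ^ (m - 1); \<And>i. x $ s \<le> x $ i\<rbrakk>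
      \<Longrightarrow> x $ j \<le> K * x $ s" by blast
  obtain "is" where "is": "length is = m - 1" "l \<in> set is" "0 < t (j # is)"
    using step(2) by (auto simp: arc_iff)
  show ?case
  \<comment> \<open>The arc contributes a term at least
    \<open>t (j # is) * x $ l * x $ s ^ (m - 2)\<close> to row \<open>j\<close>, while the row is at
    most \<open>M * (K * x $ s) ^ (m - 1)\<close>. Cancelling \<open>x $ s ^ (m - 2)\<close> gives
    this constant.\<close>
  proof (intro exI[of _ "M * K ^ (m - 1) / t (j # is)"] conjI allI impI)
    fix x :: "real ^ 'n"
    assume x: "\<forall>i. 0 < x $ i" "\<forall>i. row_form x i \<le> M * x $ i ^ (m - 1)" "\<forall>i. x $ s \<le> x $ i"
    have m: "m - 1 = Suc (m - 2)" "m - 1 - 1 = m - 2" using order_ge_2 by simp_all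
    have pow: "x $ s ^ (m - Suc 0) = x $ s * x $ s ^ (m - 2)"
      using m(1) by (metis One_nat_def power_Suc)
    have "t (j # is) * (x $ l * x $ s ^ (m - 2)) \<le> t (j # is) * monomial_at x is"
      using monomial_at_ge_remove[of "x $ s" x l "is"] x "is" m(2)
      by (intro mult_left_mono nonneg) (auto simp: less_imp_le simp del: diff_diff_left)
    also have "\<dots> \<le> row_form x j"
      by (rule row_form_ge_term) (use x "is" in \<open>auto simp: less_imp_le\<close>)
    also have "\<dots> \<le> M * x $ j ^ (m - 1)" using x by blast
    also have "\<dots> \<le> M * (K * x $ s) ^ (m - 1)"
      using K x assms(1) by (intro mult_left_mono power_mono) (auto simp: less_imp_le)
    finally have "t (j # is) * x $ l * x $ s ^ (m - 2) \<le> M * K ^ (m - 1) * x $ s * x $ s ^ (m - 2)"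
      by (simp add: pow power_mult_distrib algebra_simps)
    moreover have "0 < x $ s ^ (m - 2)" using x by simp
    ultimately have "t (j # is) * x $ l \<le> M * K ^ (m - 1) * x $ s"
      by (metis mult_le_cancel_right_pos)
    then show "x $ l \<le> M * K ^ (m - 1) / t (j # is) * x $ s"
      using "is" by (simp add: field_simps)
  qed (use K assms "is" in auto)
qed

lemma ex_uniform_growth_bound:
  assumes "0 \<le> M"
  obtains K where "1 \<le> K"
    "\<And>x i j. \<lbrakk>\<And>i. 0 < x $ i; \<And>i. row_form x i \<le> M * x $ i ^ (m - 1)\<rbrakk> \<Longrightarrow> x $ j \<le> K * x $ i"
proof -
  have "\<forall>s j. \<exists>K\<ge>0. \<forall>x. (\<forall>i. 0 < x $ i) \<longrightarrow> (\<forall>i. row_form x i \<le> M * x $ i ^ (m - 1)) \<longrightarrow>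
    (\<forall>i. x $ s \<le> x $ i) \<longrightarrow> x $ j \<le> K * x $ s"
    using ex_growth_bound[OF assms irreducible] by blast
  then obtain k where k: "\<And>s j. 0 \<le> k s j"
    "\<And>s j x. \<lbrakk>\<And>i. 0 < x $ i; \<And>i. row_form x i \<le> M * x $ i ^ (m - 1); \<And>i. x $ s \<le> x $ i\<rbrakk>
      \<Longrightarrow> x $ j \<le> k s j * x $ s"
    by metis
  \<comment> \<open>The sum dominates every \<open>k s j\<close> because all are nonnegative; the
    summand 1 puts the all-ones vector into the box \<open>[1 / K, 1]\<close> used for
    compactness.\<close>
  define K where "K = 1 + (\<Sum>s\<in>UNIV. \<Sum>j\<in>UNIV. k s j)"
  have "k s j \<le> (\<Sum>s\<in>UNIV. \<Sum>j\<in>UNIV. k s j)" for s j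
    by (rule order_trans[OF member_le_sum[of j UNIV "k s"] member_le_sum[of s UNIV "\<lambda>s. \<Sum>j\<in>UNIV. k s j"]])
       (auto intro: k sum_nonneg)
  then have kK: "k s j \<le> K" for s j by (smt (verit) K_def)
  show thesis
  proof (rule that)
    show "1 \<le> K" by (auto simp: K_def intro!: sum_nonneg k)
    fix x :: "real ^ 'n" and i j
    assume x: "\<And>i. 0 < x $ i" "\<And>i. row_form x i \<le> M * x $ i ^ (m - 1)"
    obtain s where s: "\<And>i. x $ s \<le> x $ i"
      using arg_min_least[of UNIV _ "\<lambda>i. x $ i"] by (metis UNIV_I UNIV_not_empty finite)
    have "x $ j \<le> k s j * x $ s" using k(2) x s by blast
    also have "\<dots> \<le> K * x $ i" using kK k(1) x s \<open>1 \<le> K\<close> by (intro mult_mono) (auto simp: less_imp_le)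
    finally show "x $ j \<le> K * x $ i" .
  qed
qed

section \<open>Minimising the Collatz-Wielandt ratio\<close>

definition superharmonic :: "real \<Rightarrow> real ^ 'n \<Rightarrow> bool" where
  "superharmonic r x \<longleftrightarrow> (\<forall>i. 0 < x $ i) \<and> (\<forall>i. row_form x i \<le> r * x $ i ^ (m - 1))"

lemma ex_least_superharmonic:
  obtains r x where "superharmonic r x" "\<And>r' y. superharmonic r' y \<Longrightarrow> r \<le> r'"
proof -
  \<comment> \<open>\<open>M\<close> dominates all row sums, so the all-ones vector has ratio at
    most \<open>M\<close>, and only ratios up to \<open>M\<close> compete.\<close>
  define M where "M = (\<Sum>i\<in>UNIV. row_sum i)"
  have M: "row_sum i \<le> M" for i
    unfolding M_def by (intro member_le_sum) (auto intro: row_sum_nonneg)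
  have M0: "0 \<le> M" unfolding M_def by (intro sum_nonneg row_sum_nonneg)
  obtain K where K: "1 \<le> K"
    "\<And>x i j. \<lbrakk>\<And>i. 0 < x $ i; \<And>i. row_form x i \<le> M * x $ i ^ (m - 1)\<rbrakk> \<Longrightarrow> x $ j \<le> K * x $ i"
    using ex_uniform_growth_bound[OF M0] by blast
  \<comment> \<open>After scaling the largest entry to 1, the growth bound puts all entries in
    \<open>[1 / K, 1]\<close>. On this compact set of pairs the first component attains its
    minimum.\<close>
  define S :: "(real \<times> (real ^ 'n)) set" where
    "S = {0..M} \<times> cbox (\<chi> i. 1 / K) (\<chi> i. 1) \<inter>
      {p. \<forall>i. row_form (snd p) i \<le> fst p * snd p $ i ^ (m - 1)}"
  have "compact S" unfolding S_def row_form_def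
    by (intro compact_Int_closed compact_Times compact_cbox compact_Icc closed_Collect_all
         closed_Collect_le continuous_intros)
  moreover have "(M, \<chi> i. 1) \<in> S"
    using M M0 K by (auto simp: S_def mem_box_cart row_form_const)
  ultimately obtain p where p: "p \<in> S" "\<And>q. q \<in> S \<Longrightarrow> fst p \<le> fst q"
    using continuous_attains_inf[of S fst] continuous_on_fst[OF continuous_on_id] by (metis empty_iff)
  show thesis
  proof (rule that[of "fst p" "snd p"])
    have "0 < 1 / K" using K(1) by simp
    moreover have "1 / K \<le> snd p $ i" for i
      using p(1) by (auto simp: S_def mem_box_cart)
    ultimately have "0 < snd p $ i" for i by (rule less_le_trans)
    then show "superharmonic (fst p) (snd p)"
      using p(1) by (auto simp: S_def superharmonic_def)
  next
    fix r y assume y: "superharmonic r y"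
    show "fst p \<le> r"
    proof (cases "r \<le> M")
      case False
      then show ?thesis using p(1) by (auto simp: S_def)
    next
      case True
      obtain s where s: "\<And>i. y $ i \<le> y $ s"
        using arg_min_least[of UNIV _ "\<lambda>i. - y $ i"] by (metis UNIV_I UNIV_not_empty finite neg_le_iff_le)
      have pos: "0 < y $ i" for i using y by (simp add: superharmonic_def)
      have "row_form y i \<le> M * y $ i ^ (m - 1)" for i
      proof -
        have "row_form y i \<le> r * y $ i ^ (m - 1)" using y by (simp add: superharmonic_def)
        also have "\<dots> \<le> M * y $ i ^ (m - 1)" using True pos by (intro mult_right_mono) (auto simp: less_imp_le)
        finally show ?thesis .
      qed
      then have bd: "y $ s \<le> K * y $ i" for i using K(2) pos by blast
      have "0 \<le> r * y $ s ^ (m - 1)"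
        using y row_form_nonneg[of y s] pos by (force simp: superharmonic_def less_imp_le intro: order_trans)
      moreover have "0 < y $ s ^ (m - 1)" using pos by simp
      ultimately have r: "0 \<le> r" by (meson mult_neg_pos not_less)
      \<comment> \<open>\<open>s\<close> indexes the largest entry of \<open>y\<close>. Both sides
        of the defining inequality are homogeneous of degree \<open>m - 1\<close>, so scaling
        preserves it.\<close>
      let ?z = "inverse (y $ s) *\<^sub>R y"
      have "row_form ?z i \<le> r * ?z $ i ^ (m - 1)" for i
      proof -
        have "inverse (y $ s) ^ (m - 1) * row_form y i \<le> inverse (y $ s) ^ (m - 1) * (r * y $ i ^ (m - 1))"
          using y pos[of s] by (intro mult_left_mono) (auto simp: superharmonic_def less_imp_le)
        then show ?thesis by (simp add: row_form_scale power_mult_distrib mult.left_commute)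
      qed
      then have "(r, ?z) \<in> S"
        using r True bd s pos[of s] K(1)
        by (auto simp: S_def mem_box_cart field_simps)
      then show ?thesis using p(2) by force
    qed
  qed
qed

text \<open>
  Among the vectors attaining the least ratio, take one with the fewest tight coordinates. If some
  coordinate were slack, an arc from a tight \<open>i\<close> to a slack \<open>j\<close> would exist, and decreasing
  $x_j$ slightly would make \<open>i\<close> slack without making any other coordinate tight.
\<close>

lemma ex_positive_eigenvector:
  obtains r x where "0 \<le> r" "\<And>i. 0 < x $ i" "\<And>i. row_form x i = r * x $ i ^ (m - 1)"
proof -
  obtain r x0 where r: "superharmonic r x0" "\<And>r' y. superharmonic r' y \<Longrightarrow> r \<le> r'"
    using ex_least_superharmonic by blast
  define I where "I x = {i. row_form x i = r * x $ i ^ (m - 1)}" for x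
  obtain x where x: "superharmonic r x" and least: "\<And>y. superharmonic r y \<Longrightarrow> card (I x) \<le> card (I y)"
    using ex_has_least_nat[of "superharmonic r" x0 "card \<circ> I"] r(1) by auto
  have pos: "0 < x $ i" and le: "row_form x i \<le> r * x $ i ^ (m - 1)" for i
    using x by (auto simp: superharmonic_def)
  have slack: "row_form x i < r * x $ i ^ (m - 1)" if "i \<notin> I x" for i
    using le[of i] that by (auto simp: I_def)
  \<comment> \<open>With every coordinate slack, the largest of the finitely many ratios would be an
    admissible value below \<open>r\<close>.\<close>
  have "I x \<noteq> {}"
  proof
    assume empty: "I x = {}"
    define q where "q = Max (range (\<lambda>i. row_form x i / x $ i ^ (m - 1)))"
    have "row_form x i / x $ i ^ (m - 1) \<le> q" for i by (simp add: q_def)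
    then have "superharmonic q x" using pos by (simp add: superharmonic_def divide_le_eq)
    then have "r \<le> q" by (rule r(2))
    moreover have "q < r"
      unfolding q_def using slack empty pos by (subst Max_less_iff) (auto simp: divide_less_eq)
    ultimately show False by simp
  qed
  have "I x = UNIV"
  proof (rule ccontr)
    assume "I x \<noteq> UNIV"
    with \<open>I x \<noteq> {}\<close> obtain i j where ij: "i \<in> I x" "j \<notin> I x" "(i, j) \<in> parcs G"
      by (metis ex_arc_leaving ex_in_conv UNIV_eq_I)
    \<comment> \<open>Slackness at \<open>j\<close> is a strict inequality, so by continuity it
      survives some factor \<open>s < 1\<close>. The old row form may stay on the left, since
      decreasing an entry cannot increase it.\<close>
    have "((\<lambda>s. r * (s * x $ j) ^ (m - 1)) \<longlongrightarrow> r * (1 * x $ j) ^ (m - 1)) (at_left 1)"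
      by (intro tendsto_intros)
    then have "\<forall>\<^sub>F s in at_left 1. row_form x j < r * (s * x $ j) ^ (m - 1)"
      by (rule order_tendstoD) (use slack ij in simp)
    moreover have "\<forall>\<^sub>F s :: real in at_left 1. s \<in> {0<..<1}"
      by (rule eventually_at_leftI[of 0]) auto
    ultimately have "\<forall>\<^sub>F s in at_left 1. row_form x j < r * (s * x $ j) ^ (m - 1) \<and> s \<in> {0<..<1}"
      by (rule eventually_conj)
    then obtain s where s: "row_form x j < r * (s * x $ j) ^ (m - 1)" "0 < s" "s < 1"
      using eventually_happens[of _ "at_left (1::real)"] trivial_limit_at_left_real by fastforce
    define y where "y = (\<chi> l. if l = j then s * x $ j else x $ l)"
    have ypos: "0 < y $ l" for l using pos s by (simp add: y_def)
    have yx: "y $ l \<le> x $ l" for l using pos[of j] s by (simp add: y_def mult_le_cancel_right1)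
    have mono: "row_form y l \<le> row_form x l" for l
      by (rule row_form_mono) (use ypos yx in \<open>auto simp: less_imp_le\<close>)
    have "y $ j < x $ j" using pos[of j] s by (simp add: y_def)
    then have "row_form y i < row_form x i"
      using ypos yx ij(3) by (intro row_form_strict_mono) auto
    then have i: "row_form y i < r * y $ i ^ (m - 1)" using ij by (auto simp: I_def y_def)
    have j: "row_form y j < r * y $ j ^ (m - 1)" using mono[of j] s by (simp add: y_def)
    have other: "row_form y l \<le> r * y $ l ^ (m - 1)" "l \<in> I y \<Longrightarrow> l \<in> I x" if "l \<noteq> j" for l
      using mono[of l] le[of l] that by (auto simp: y_def I_def)
    have "superharmonic r y"
      unfolding superharmonic_def using ypos j other by (metis less_imp_le)
    then have "card (I x) \<le> card (I y)" by (rule least)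
    moreover have "I y \<subseteq> I x - {i}" using i j other(2) by (force simp: I_def)
    then have "card (I y) < card (I x)" using ij by (intro psubset_card_mono) auto
    ultimately show False by simp
  qed
  then have eq: "row_form x i = r * x $ i ^ (m - 1)" for i by (auto simp: I_def)
  moreover have "0 \<le> r"
  proof -
    obtain i :: 'n where True by simp
    have "0 \<le> r * x $ i ^ (m - 1)" "0 < x $ i ^ (m - 1)"
      using eq[of i] row_form_nonneg[of x i] pos by (simp_all add: less_imp_le)
    then show ?thesis by (meson mult_neg_pos not_less)
  qed
  ultimately show thesis using that pos by blast
qed

section \<open>The spectral radius as the positive eigenvalue\<close>

lemma tensor_apply_nth:
  "tensor_apply m T z $ i = (\<Sum>is\<in>{is. length is = m - 1}. T (i # is) * (\<Prod>j\<leftarrow>is. z $ j))"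
  by (simp add: tensor_apply_def)

lemma norm_eigenvalue_le:
  assumes pos: "\<And>i. 0 < x $ i" and eq: "\<And>i. row_form x i = r * x $ i ^ (m - 1)"
    and "tensor_eigenvalue m T l"
  shows "cmod l \<le> r"
proof -
  obtain z where "z \<noteq> 0" and z: "\<And>i. tensor_apply m T z $ i = l * z $ i ^ (m - 1)"
    using assms(3) by (auto simp: tensor_eigenvalue_def)
  \<comment> \<open>The least multiple of \<open>x\<close> that dominates the moduli of
    \<open>z\<close> touches them at some \<open>s\<close>. There the triangle inequality and
    monotonicity compare \<open>cmod l\<close> with \<open>r\<close> against the same positive
    power.\<close>
  define c where "c = Max (range (\<lambda>i. cmod (z $ i) / x $ i))"
  have "c \<in> range (\<lambda>i. cmod (z $ i) / x $ i)" unfolding c_def by (rule Max_in) auto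
  then obtain s where s: "c = cmod (z $ s) / x $ s" by blast
  have "cmod (z $ i) / x $ i \<le> c" for i by (simp add: c_def)
  then have dom: "cmod (z $ i) \<le> c * x $ i" for i using pos by (simp add: divide_le_eq)
  obtain i where "z $ i \<noteq> 0" using \<open>z \<noteq> 0\<close> by (auto simp: vec_eq_iff)
  then have "0 < c" using dom[of i] pos[of i] by (smt (verit) zero_less_mult_pos2 zero_less_norm_iff)
  then have zs: "0 < cmod (z $ s)" and cs: "cmod (z $ s) = c * x $ s"
    using s pos[of s] by (auto simp: zero_less_divide_iff)
  have "cmod l * cmod (z $ s) ^ (m - 1) = cmod (tensor_apply m T z $ s)"
    by (simp add: z norm_mult norm_power)
  also have "\<dots> \<le> row_form (\<chi> i. cmod (z $ i)) s"
    unfolding tensor_apply_nth row_form_def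
    by (rule sum_norm_le) (simp add: norm_mult norm_prod_list_nth nonneg)
  also have "\<dots> \<le> row_form (c *\<^sub>R x) s"
    by (rule row_form_mono) (use dom in auto)
  also have "\<dots> = r * cmod (z $ s) ^ (m - 1)"
    by (simp add: row_form_scale eq cs power_mult_distrib)
  finally show ?thesis using zs by simp
qed

text \<open>The positive eigenvector, read over the complex numbers, makes \<open>r\<close> itself
  an eigenvalue, and no eigenvalue has larger modulus, so the \<open>GREATEST\<close>
  exists.\<close>

lemma spectral_radius_eq:
  assumes pos: "\<And>i. 0 < x $ i" and eq: "\<And>i. row_form x i = r * x $ i ^ (m - 1)" and "0 \<le> r"
  shows "tensor_spectral_radius m T = r"
  unfolding tensor_spectral_radius_def
proof (rule Greatest_equality)
  let ?z = "\<chi> i. complex_of_real (x $ i)"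
  have "?z \<noteq> 0" using pos by (metis less_irrefl of_real_eq_0_iff vec_lambda_beta zero_index)
  moreover have "tensor_apply m T ?z $ i = complex_of_real r * ?z $ i ^ (m - 1)" for i
    using arg_cong[OF eq[of i], of complex_of_real]
    by (simp add: tensor_apply_nth of_real_monomial_at[simplified] row_form_def)
  ultimately have "tensor_eigenvalue m T (complex_of_real r)"
    by (auto simp: tensor_eigenvalue_def vec_eq_iff intro!: exI[of _ ?z])
  then show "\<exists>l. tensor_eigenvalue m T l \<and> r = cmod l" using \<open>0 \<le> r\<close> by force
qed (use norm_eigenvalue_le[OF pos eq] in blast)

text \<open>
  In $\rho x_i^{m-1} = \sum t_{i i_2 \cdots i_m} x_{i_2} \cdots x_{i_m}$ replace every factor by the
  largest (smallest) entry of \<open>x\<close> on an out-neighbour of \<open>i\<close>; along a circuit of the resulting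
  self-map the powers of \<open>x\<close> cancel.
\<close>

theorem spectral_radius_circuit_bounds:
  "Min (circuit_mean row_sum ` circuits G) \<le> tensor_spectral_radius m T"
  "tensor_spectral_radius m T \<le> Max (circuit_mean row_sum ` circuits G)"
proof -
  obtain r x where r: "0 \<le> r" and x: "\<And>i. 0 < x $ i" and eq: "\<And>i. row_form x i = r * x $ i ^ (m - 1)"
    using ex_positive_eigenvector by blast
  have rho: "tensor_spectral_radius m T = r" by (rule spectral_radius_eq[OF x eq r])
  have "\<exists>j. (i, j) \<in> parcs G \<and> (\<forall>l. (i, l) \<in> parcs G \<longrightarrow> x $ l \<le> x $ j)" for i
    using ex_out_arc arg_min_if_finite[of "{j. (i, j) \<in> parcs G}" "\<lambda>j. - x $ j"]
    by (metis (no_types, lifting) empty_Collect_eq finite mem_Collect_eq neg_less_iff_less not_less)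
  then obtain f where f: "\<And>i. (i, f i) \<in> parcs G" "\<And>i l. (i, l) \<in> parcs G \<Longrightarrow> x $ l \<le> x $ f i"
    by metis
  have "\<exists>j. (i, j) \<in> parcs G \<and> (\<forall>l. (i, l) \<in> parcs G \<longrightarrow> x $ j \<le> x $ l)" for i
    using ex_out_arc arg_min_if_finite[of "{j. (i, j) \<in> parcs G}" "\<lambda>j. x $ j"]
    by (metis (no_types, lifting) empty_Collect_eq finite mem_Collect_eq not_less)
  then obtain g where g: "\<And>i. (i, g i) \<in> parcs G" "\<And>i l. (i, l) \<in> parcs G \<Longrightarrow> x $ g i \<le> x $ l"
    by metis
  have x0: "0 \<le> x $ i" for i using x[of i] by simp
  \<comment> \<open>A tuple with nonzero coefficient has only out-neighbours of \<open>i\<close> in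
    its tail, so the extremal choices bound each factor; all other tuples contribute 0 to both
    sides.\<close>
  have arc: "(i, l) \<in> parcs G" if "length is = m - 1" "l \<in> set is" "t (i # is) \<noteq> 0" for i l "is"
    using that nonneg[of "i # is"] by (auto simp: arc_iff)
  have upper: "r * x $ i ^ (m - 1) \<le> row_sum i * x $ f i ^ (m - 1)" for i
  proof -
    have "t (i # is) * monomial_at x is \<le> t (i # is) * x $ f i ^ (m - 1)" if "length is = m - 1" for "is"
      using monomial_at_mono[of "is" x "\<chi> j. x $ f i"] that arc f(2) x0 nonneg
      by (cases "t (i # is) = 0") (auto intro!: mult_left_mono simp: monomial_at_const)
    then show ?thesis
      unfolding eq[symmetric] row_form_def row_sum_def sum_distrib_right by (intro sum_mono) auto
  qed
  have lower: "row_sum i * x $ g i ^ (m - 1) \<le> r * x $ i ^ (m - 1)" for i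
  proof -
    have "t (i # is) * x $ g i ^ (m - 1) \<le> t (i # is) * monomial_at x is" if "length is = m - 1" for "is"
      using monomial_at_mono[of "is" "\<chi> j. x $ g i" x] that arc g(2) x0 nonneg
      by (cases "t (i # is) = 0") (auto intro!: mult_left_mono simp: monomial_at_const)
    then show ?thesis
      unfolding eq[symmetric] row_form_def row_sum_def sum_distrib_right by (intro sum_mono) auto
  qed
  obtain \<gamma> where \<gamma>: "\<gamma> \<in> circuits G" "\<gamma> \<noteq> []" "distinct \<gamma>" "prod (\<lambda>_. r) (set \<gamma>) \<le> prod row_sum (set \<gamma>)"
    using ex_circuit_of_subinvariant_weight[OF pverts_G f(1), of "\<lambda>i. x $ i ^ (m - 1)" "\<lambda>_. r" row_sum]
      x r row_sum_nonneg upper by auto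
  have "r = circuit_mean (\<lambda>_. r) \<gamma>" using circuit_mean_const[OF \<gamma>(3,2) r] by simp
  also have "\<dots> \<le> circuit_mean row_sum \<gamma>" using \<gamma> r by (intro circuit_mean_mono) auto
  also have "\<dots> \<le> Max (circuit_mean row_sum ` circuits G)" using \<gamma> by (intro Max_ge) (auto simp: finite_circuits)
  finally show "tensor_spectral_radius m T \<le> Max (circuit_mean row_sum ` circuits G)" by (simp add: rho)
  \<comment> \<open>Reciprocal weights move \<open>g i\<close> to the right-hand side, so the same
    circuit lemma applies with the roles of \<open>row_sum\<close> and \<open>r\<close>
    exchanged.\<close>
  have lower': "row_sum i * inverse (x $ i ^ (m - 1)) \<le> r * inverse (x $ g i ^ (m - 1))" for i
    using lower[of i] x[of i] x[of "g i"] by (simp add: field_simps)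
  obtain \<gamma> where \<gamma>: "\<gamma> \<in> circuits G" "\<gamma> \<noteq> []" "distinct \<gamma>" "prod row_sum (set \<gamma>) \<le> prod (\<lambda>_. r) (set \<gamma>)"
    using ex_circuit_of_subinvariant_weight[OF pverts_G g(1), of "\<lambda>i. inverse (x $ i ^ (m - 1))" row_sum "\<lambda>_. r"]
      x r row_sum_nonneg lower' by auto
  have "Min (circuit_mean row_sum ` circuits G) \<le> circuit_mean row_sum \<gamma>"
    using \<gamma> by (intro Min_le) (auto simp: finite_circuits)
  also have "\<dots> \<le> circuit_mean (\<lambda>_. r) \<gamma>"
    using \<gamma> row_sum_nonneg by (intro circuit_mean_mono) auto
  also have "\<dots> = r" using circuit_mean_const[OF \<gamma>(3,2) r] by simp
  finally show "Min (circuit_mean row_sum ` circuits G) \<le> tensor_spectral_radius m T" by (simp add: rho)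
qed

end

section \<open>The tensors of a hypergraph\<close>

text \<open>For each edge \<open>e\<close> containing \<open>i\<close>, the tails that complete
  \<open>i\<close> to \<open>e\<close> are the \<open>fact (k - 1)\<close> orderings of
  \<open>e - {i}\<close>; this count cancels the normalising factor.\<close>

lemma sum_edge_indicator:
  fixes E :: "'n::finite set set"
  assumes "uniform_hypergraph k E" "1 \<le> k"
  shows "(\<Sum>is\<in>{is. length is = k - 1}. if set (i # is) \<in> E then 1 / fact (k - 1) else 0 :: real) = real (hdegree E i)"
proof -
  let ?P = "\<lambda>e. permutations_of_set (e - {i})"
  have card: "card e = k" if "e \<in> E" for e using assms that by (auto simp: uniform_hypergraph_def)
  have "{is. length is = k - 1 \<and> set (i # is) \<in> E} = (\<Union>e\<in>{e \<in> E. i \<in> e}. ?P e)"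
  proof (intro equalityI subsetI)
    fix "is" assume a: "is \<in> {is. length is = k - 1 \<and> set (i # is) \<in> E}"
    then have c: "card (set (i # is)) = length (i # is)" using card assms(2) by auto
    then have "distinct (i # is)" by (rule card_distinct)
    then have "is \<in> ?P (set (i # is))" by (auto simp: permutations_of_set_def)
    then show "is \<in> (\<Union>e\<in>{e \<in> E. i \<in> e}. ?P e)" using a by auto
  next
    fix "is" assume "is \<in> (\<Union>e\<in>{e \<in> E. i \<in> e}. ?P e)"
    then obtain e where e: "e \<in> E" "i \<in> e" "set is = e - {i}" "distinct is"
      by (auto simp: permutations_of_set_def)
    then have "length is = k - 1" by (metis card card_Diff_singleton distinct_card)
    moreover have "set (i # is) = e" using e by auto
    ultimately show "is \<in> {is. length is = k - 1 \<and> set (i # is) \<in> E}" using e by simp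
  qed
  \<comment> \<open>A tail determines its edge, since adding \<open>i\<close> back to its entries
    recovers \<open>e\<close>.\<close>
  moreover have "?P e \<inter> ?P e' = {}" if "i \<in> e" "i \<in> e'" "e \<noteq> e'" for e e'
    using that by (metis disjoint_iff insert_Diff permutations_of_setD(1))
  then have "card (\<Union>e\<in>{e \<in> E. i \<in> e}. ?P e) = (\<Sum>e\<in>{e \<in> E. i \<in> e}. card (?P e))"
    by (intro card_UN_disjoint) auto
  moreover have "card (?P e) = fact (k - 1)" if "e \<in> E" "i \<in> e" for e
    using that card by simp
  ultimately have "card {is. length is = k - 1 \<and> set (i # is) \<in> E} = hdegree E i * fact (k - 1)"
    by (simp add: hdegree_def)
  then show ?thesis
    by (simp add: sum.If_cases Collect_conj_eq[symmetric] Int_def)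
qed

text \<open>If no edge held two distinct vertices, every path would stay at its starting vertex, and
  two different vertices could not be connected.\<close>

lemma hypergraph_uniformity_ge_2:
  fixes E :: "'n::finite set set"
  assumes "CARD('n) \<ge> 2" "uniform_hypergraph k E" "hypergraph_connected E"
  shows "2 \<le> k"
proof -
  obtain u v :: 'n where "u \<noteq> v"
    using assms(1) card_le_Suc0_iff_eq[of "UNIV :: 'n set"] by force
  have "\<exists>a b. a \<noteq> b \<and> (\<exists>e\<in>E. a \<in> e \<and> b \<in> e)"
  proof (rule ccontr)
    assume no: "\<not> ?thesis"
    have "(u, v) \<in> {(a, b). \<exists>e\<in>E. a \<in> e \<and> b \<in> e}\<^sup>*"
      using assms(3) by (simp add: hypergraph_connected_def)
    then have "u = v"
      by (induction rule: rtrancl_induct) (use no in blast)+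
    then show False using \<open>u \<noteq> v\<close> by simp
  qed
  then obtain a b e where "a \<noteq> b" "e \<in> E" "{a, b} \<subseteq> e" by auto
  then have "card {a, b} \<le> k" using assms(2) unfolding uniform_hypergraph_def by (metis card_mono finite)
  then show ?thesis using \<open>a \<noteq> b\<close> by simp
qed

text \<open>For distinct \<open>a\<close> and \<open>b\<close> in an edge \<open>e\<close>, any
  ordering of \<open>e - {a}\<close> is a tail witnessing the arc from \<open>a\<close> to
  \<open>b\<close>, so paths in the hypergraph become paths in the digraph. Only the entries on
  edges matter, which covers both tensors.\<close>

lemma weakly_irreducible_tensor_of_hypergraph:
  fixes E :: "'n::finite set set"
  assumes "CARD('n) \<ge> 2" "uniform_hypergraph k E" "hypergraph_connected E"
    and "\<And>is. 0 \<le> t is" and t: "\<And>is. set is \<in> E \<Longrightarrow> t is \<noteq> 0"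
  shows "weakly_irreducible_tensor k t"
proof
  fix i j :: 'n
  let ?A = "parcs (tensor_digraph k (\<lambda>is. complex_of_real (t is)))"
  have "(a, b) \<in> ?A\<^sup>*" if e: "e \<in> E" "a \<in> e" "b \<in> e" for a b e
  proof (cases "a = b")
    case False
    obtain "is" where "is": "set is = e - {a}" "distinct is"
      using finite_distinct_list[of "e - {a}"] by auto
    have "card e = k" using assms(2) e by (simp add: uniform_hypergraph_def)
    then have "length is = k - 1" using "is" e by (metis card_Diff_singleton distinct_card)
    moreover have "set (a # is) = e" using "is" e by auto
    moreover have "b \<in> set is" using "is" e False by auto
    ultimately have "(a, b) \<in> ?A"
      using t[of "a # is"] e by (auto simp: tensor_digraph_def)
    then show ?thesis by blast
  qed simp
  then have "{(a, b). \<exists>e\<in>E. a \<in> e \<and> b \<in> e}\<^sup>* \<subseteq> ?A\<^sup>*"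
    by (intro rtrancl_subset_rtrancl) auto
  then show "(i, j) \<in> ?A\<^sup>*"
    using assms(3) by (auto simp: hypergraph_connected_def)
qed (use assms in auto)

text \<open>On a single vertex the adjacency digraph has no arc, and the minimum and maximum would
  range over an empty set of circuits; hence at least two vertices are required.\<close>

theorem theorem3p2:
  fixes E :: "'n::finite set set" and k :: nat
  assumes "CARD('n) \<ge> 2"
    and "uniform_hypergraph k E"
    and "hypergraph_connected E"
  shows
    "(MIN \<gamma>\<in>circuits (tensor_digraph k (adjacency_tensor k E)).
        (\<Prod>i\<in>set \<gamma>. real (hdegree E i)) powr (1 / real (length \<gamma>)))
       \<le> tensor_spectral_radius k (adjacency_tensor k E)
     \<and> tensor_spectral_radius k (adjacency_tensor k E)
       \<le> (MAX \<gamma>\<in>circuits (tensor_digraph k (adjacency_tensor k E)).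
            (\<Prod>i\<in>set \<gamma>. real (hdegree E i)) powr (1 / real (length \<gamma>)))
     \<and> (MIN \<gamma>\<in>circuits (tensor_digraph k (signless_laplacian_tensor k E)).
        (\<Prod>i\<in>set \<gamma>. 2 * real (hdegree E i)) powr (1 / real (length \<gamma>)))
       \<le> tensor_spectral_radius k (signless_laplacian_tensor k E)
     \<and> tensor_spectral_radius k (signless_laplacian_tensor k E)
       \<le> (MAX \<gamma>\<in>circuits (tensor_digraph k (signless_laplacian_tensor k E)).
            (\<Prod>i\<in>set \<gamma>. 2 * real (hdegree E i)) powr (1 / real (length \<gamma>)))"
proof -
  \<comment> \<open>\<open>a\<close> and \<open>q\<close> are real-valued copies of the two complex
    tensors, as the locale expects.\<close>
  define a :: "'n list \<Rightarrow> real" where "a is = (if set is \<in> E then 1 / fact (k - 1) else 0)" for "is"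
  define q :: "'n list \<Rightarrow> real" where
    "q is = (if is = replicate k (hd is) then real (hdegree E (hd is)) else 0) + a is" for "is"
  have k: "2 \<le> k" by (rule hypergraph_uniformity_ge_2[OF assms])
  have A: "adjacency_tensor k E = (\<lambda>is. complex_of_real (a is))"
    by (auto simp: adjacency_tensor_def a_def)
  have Q: "signless_laplacian_tensor k E = (\<lambda>is. complex_of_real (q is))"
    by (auto simp: signless_laplacian_tensor_def degree_tensor_def A q_def)
  have a_nonneg: "0 \<le> a is" for "is" by (simp add: a_def)
  have q_ge: "a is \<le> q is" for "is" by (simp add: q_def)
  have a_pos: "0 < a is" if "set is \<in> E" for "is" using that by (simp add: a_def)
  interpret A: weakly_irreducible_tensor k a
    by (rule weakly_irreducible_tensor_of_hypergraph[OF assms]) (use a_nonneg in \<open>auto simp: a_def\<close>)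
  interpret Q: weakly_irreducible_tensor k q
  proof (rule weakly_irreducible_tensor_of_hypergraph[OF assms])
    show "0 \<le> q is" for "is" using a_nonneg[of "is"] q_ge[of "is"] by linarith
    show "q is \<noteq> 0" if "set is \<in> E" for "is" using a_pos[OF that] q_ge[of "is"] by linarith
  qed
  have A_row: "A.row_sum = (\<lambda>i. real (hdegree E i))"
    using sum_edge_indicator[OF assms(2)] k by (simp add: fun_eq_iff A.row_sum_def a_def)
  \<comment> \<open>Exactly one tail completes \<open>i\<close> to a diagonal tuple, so the degree
    tensor adds the degree of \<open>i\<close> once to the row sum and thereby doubles it.\<close>
  have diag: "i # is = replicate k i \<longleftrightarrow> is = replicate (k - 1) i" for i :: 'n and "is"
    using k by (cases k) auto
  have Q_row: "Q.row_sum = (\<lambda>i. 2 * real (hdegree E i))"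
  proof
    fix i
    have "Q.row_sum i = (\<Sum>is\<in>{is. length is = k - 1}. if is = replicate (k - 1) i then real (hdegree E i) else 0) + A.row_sum i"
      by (simp add: Q.row_sum_def A.row_sum_def q_def diag sum.distrib)
    also have "\<dots> = 2 * real (hdegree E i)" by (simp add: sum.delta A_row)
    finally show "Q.row_sum i = 2 * real (hdegree E i)" .
  qed
  show ?thesis
    using A.spectral_radius_circuit_bounds Q.spectral_radius_circuit_bounds
    unfolding A Q A_row Q_row circuit_mean_def by blast
qed

end
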